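(* Let $(\mathcal{C},\otimes,\mathbb{1})$ be a monoidal category. A left closed structure on it (for each object $c$, a functor $[c,-]\colon\mathcal{C}\to\mathcal{C}$ and an adjunction $c\otimes-\dashv[c,-]$ with specified counit and unit) can equivalently be given as a functor ${\multimap}\colon\mathcal{C}^{\mathrm{op}}\times\mathcal{C}\to\mathcal{C}$ together with two extranatural transformations $$\mathrm{ev}\colon{\otimes}\circ(\mathrm{id}\times{\multimap})\to\mathrm{id},\qquad \mathrm{coev}\colon\mathrm{id}\to{\multimap}\circ(\mathrm{id}\times{\otimes}),$$ with components $\mathrm{ev}_{c,a}\colon c\otimes(c\multimap a)\to a$ and $\mathrm{coev}_{c,a}\colon a\to c\multimap(c\otimes a)$ (natural in $a$ and extranatural in the repeated variable $c$), satisfying the triangle identities: the composites $${\multimap}\xrightarrow{\mathrm{coev}\circ{\multimap}}{\multimap}\circ(\mathrm{id}\times{\otimes})\circ(\mathrm{id}\times\mathrm{id}\times{\multimap})\xrightarrow{{\multimap}\circ(\mathrm{id}\times\mathrm{ev})}{\multimap},$$ $${\otimes}\xrightarrow{{\otimes}\circ\mathrm{coev}}{\otimes}\circ(\mathrm{id}\times{\multimap})\circ(\mathrm{id}\times\mathrm{id}\times{\otimes})\xrightarrow{\mathrm{ev}\circ(\mathrm{id}\times\mathrm{id}\times{\otimes})}{\otimes}$$ (with components $c\multimap a\to c\multimap(c\otimes(c\multimap a))\to c\multimap a$ and $c\otimes a\to c\otimes(c\multimap(c\otimes a))\to c\otimes a$) are identities. That is, sending such data $({\multimap},\mathrm{ev},\mathrm{coev})$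 to the left closed structure with $[c,-]:=c\multimap-$ and with counits $\mathrm{ev}_{c,-}$ and units $\mathrm{coev}_{c,-}$ is a bijection from the set of such data to the set of left closed structures on $(\mathcal{C},\otimes,\mathbb{1})$.
   Context: Extranatural transformations: given functors $P\colon\mathcal{C}\times\mathcal{C}^{\mathrm{op}}\times\mathcal{A}\to\mathcal{D}$ and $Q\colon\mathcal{A}\times\mathcal{B}^{\mathrm{op}}\times\mathcal{B}\to\mathcal{D}$, an extranatural transformation from $P$ to $Q$ is a family of morphisms $\beta_{c,a,b}\colon P(c,c,a)\to Q(a,b,b)$ such that for all morphisms $f\colon c\to c'$ in $\mathcal{C}$, $h\colon a\to a'$ in $\mathcal{A}$, $g\colon b\to b'$ in $\mathcal{B}$: (i) $\beta_{c',a,b}\circ P(f,c',a)=\beta_{c,a,b}\circ P(c,f,a)\colon P(c,c',a)\to Q(a,b,b)$; (ii) $\beta_{c',a',b}\circ P(c',c',h)=Q(h,b,b)\circ\beta_{c',a,b}$; (iii) $Q(a',g,b')\circ\beta_{c',a',b'}=Q(a',b,g)\circ\beta_{c',a',b}\colon P(c',c',a')\to Q(a',b,b')$. Here an object in place of a morphism denotes its identity. Factors in the domains of $P$ and $Q$ may be permuted, and any of the categories may be the terminal category. For $\mathrm{ev}$ one takes $P(c,c',a)=c\otimes(c'\multimap a)$ and $Q(a)=a$; for $\mathrm{coev}$ one takes $P(a)=a$ and $Q(a,b,b')=b\multimap(b'\otimes a)$. *)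

theory Defs
  imports Main "HOL-Library.FuncSet"
begin

section \<open>Categories, functors, natural transformations\<close>

record ('o, 'm) cat =
  Ob :: "'o set"
  Arr :: "'m set"
  Dom :: "'m \<Rightarrow> 'o"
  Cod :: "'m \<Rightarrow> 'o"
  Id :: "'o \<Rightarrow> 'm"
  Comp :: "'m \<Rightarrow> 'm \<Rightarrow> 'm"  (infixr "\<cdot>\<index>" 70)

definition hom :: "('o, 'm, 'x) cat_scheme \<Rightarrow> 'o \<Rightarrow> 'o \<Rightarrow> 'm set" where
  "hom C x y = {f \<in> Arr C. Dom C f = x \<and> Cod C f = y}"

locale category =
  fixes C :: "('o, 'm, 'x) cat_scheme" (structure)
  assumes Dom_Ob: "f \<in> Arr C \<Longrightarrow> Dom C f \<in> Ob C"
    and Cod_Ob: "f \<in> Arr C \<Longrightarrow> Cod C f \<in> Ob C"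
    and Id_hom: "x \<in> Ob C \<Longrightarrow> Id C x \<in> hom C x x"
    and Comp_hom: "f \<in> hom C x y \<Longrightarrow> g \<in> hom C y z \<Longrightarrow> g \<cdot> f \<in> hom C x z"
    and Comp_Id: "f \<in> hom C x y \<Longrightarrow> f \<cdot> Id C x = f"
    and Id_Comp: "f \<in> hom C x y \<Longrightarrow> Id C y \<cdot> f = f"
    and Comp_assoc: "f \<in> hom C w x \<Longrightarrow> g \<in> hom C x y \<Longrightarrow> h \<in> hom C y z \<Longrightarrow>
      (h \<cdot> g) \<cdot> f = h \<cdot> (g \<cdot> f)"

definition op_cat :: "('o, 'm, 'x) cat_scheme \<Rightarrow> ('o, 'm) cat" where
  "op_cat C = \<lparr>Ob = Ob C, Arr = Arr C, Dom = Cod C, Cod = Dom C, Id = Id C,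
    Comp = (\<lambda>g f. f \<cdot>\<^bsub>C\<^esub> g)\<rparr>"

definition prod_cat ::
  "('o, 'm, 'x) cat_scheme \<Rightarrow> ('p, 'n, 'y) cat_scheme \<Rightarrow> ('o \<times> 'p, 'm \<times> 'n) cat" where
  "prod_cat C D = \<lparr>Ob = Ob C \<times> Ob D, Arr = Arr C \<times> Arr D,
    Dom = map_prod (Dom C) (Dom D), Cod = map_prod (Cod C) (Cod D),
    Id = map_prod (Id C) (Id D),
    Comp = (\<lambda>(g, g') (f, f'). (g \<cdot>\<^bsub>C\<^esub> f, g' \<cdot>\<^bsub>D\<^esub> f'))\<rparr>"

definition terminal_cat :: "(unit, unit) cat" where
  "terminal_cat = \<lparr>Ob = UNIV, Arr = UNIV, Dom = id, Cod = id, Id = id, Comp = (\<lambda>_ _. ())\<rparr>"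

record ('o, 'm, 'p, 'n) fctr =
  omap :: "'o \<Rightarrow> 'p"
  amap :: "'m \<Rightarrow> 'n"

definition is_functor ::
  "('o, 'm, 'x) cat_scheme \<Rightarrow> ('p, 'n, 'y) cat_scheme \<Rightarrow> ('o, 'm, 'p, 'n) fctr \<Rightarrow> bool" where
  "is_functor C D F \<longleftrightarrow> category C \<and> category D \<and>
    (\<forall>x \<in> Ob C. omap F x \<in> Ob D) \<and>
    (\<forall>x \<in> Ob C. \<forall>y \<in> Ob C. \<forall>f \<in> hom C x y. amap F f \<in> hom D (omap F x) (omap F y)) \<and>
    (\<forall>x \<in> Ob C. amap F (Id C x) = Id D (omap F x)) \<and>
    (\<forall>x \<in> Ob C. \<forall>y \<in> Ob C. \<forall>z \<in> Ob C. \<forall>f \<in> hom C x y. \<forall>g \<in> hom C y z.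
       amap F (g \<cdot>\<^bsub>C\<^esub> f) = amap F g \<cdot>\<^bsub>D\<^esub> amap F f)"

text \<open>
  The predicate above constrains \<open>omap\<close> and \<open>amap\<close> only on the objects and arrows of the domain.
  In the following set, values outside are normalised, so that equality in HOL of its elements is
  equality of functors.
\<close>
definition functors ::
  "('o, 'm, 'x) cat_scheme \<Rightarrow> ('p, 'n, 'y) cat_scheme \<Rightarrow> ('o, 'm, 'p, 'n) fctr set" where
  "functors C D = {F. is_functor C D F \<and>
    omap F \<in> extensional (Ob C) \<and> amap F \<in> extensional (Arr C)}"

definition id_fctr :: "('o, 'm, 'o, 'm) fctr" where
  "id_fctr = \<lparr>omap = id, amap = id\<rparr>"

definition fst_fctr :: "('o \<times> 'p, 'm \<times> 'n, 'o, 'm) fctr" where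
  "fst_fctr = \<lparr>omap = fst, amap = fst\<rparr>"

definition snd_fctr :: "('o \<times> 'p, 'm \<times> 'n, 'p, 'n) fctr" where
  "snd_fctr = \<lparr>omap = snd, amap = snd\<rparr>"

definition comp_fctr ::
  "('p, 'n, 'q, 'k) fctr \<Rightarrow> ('o, 'm, 'p, 'n) fctr \<Rightarrow> ('o, 'm, 'q, 'k) fctr"
  (infixr "\<circ>\<^sub>f" 55) where
  "G \<circ>\<^sub>f F = \<lparr>omap = omap G \<circ> omap F, amap = amap G \<circ> amap F\<rparr>"

definition prod_fctr ::
  "('o, 'm, 'p, 'n) fctr \<Rightarrow> ('o', 'm', 'p', 'n') fctr \<Rightarrow>
    ('o \<times> 'o', 'm \<times> 'm', 'p \<times> 'p', 'n \<times> 'n') fctr"  (infixr "\<times>\<^sub>f" 60) where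
  "F \<times>\<^sub>f G = \<lparr>omap = map_prod (omap F) (omap G), amap = map_prod (amap F) (amap G)\<rparr>"

definition assoc_fctr ::
  "(('o \<times> 'p) \<times> 'q, ('m \<times> 'n) \<times> 'k, 'o \<times> ('p \<times> 'q), 'm \<times> ('n \<times> 'k)) fctr" where
  "assoc_fctr = \<lparr>omap = (\<lambda>((x, y), z). (x, (y, z))), amap = (\<lambda>((f, g), h). (f, (g, h)))\<rparr>"

definition rotate_fctr ::
  "('o \<times> ('p \<times> 'q), 'm \<times> ('n \<times> 'k), 'p \<times> ('q \<times> 'o), 'n \<times> ('k \<times> 'm)) fctr" where
  "rotate_fctr = \<lparr>omap = (\<lambda>(x, (y, z)). (y, (z, x))), amap = (\<lambda>(f, (g, h)). (g, (h, f)))\<rparr>"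

text \<open>Partial application: \<open>F(c, -)\<close> and \<open>F(-, d)\<close>, where the category is that of the fixed argument.\<close>
definition fix_fst ::
  "('o, 'm, 'x) cat_scheme \<Rightarrow> ('o \<times> 'p, 'm \<times> 'n, 'q, 'k) fctr \<Rightarrow> 'o \<Rightarrow> ('p, 'n, 'q, 'k) fctr" where
  "fix_fst C F c = \<lparr>omap = (\<lambda>y. omap F (c, y)), amap = (\<lambda>g. amap F (Id C c, g))\<rparr>"

definition fix_snd ::
  "('p, 'n, 'x) cat_scheme \<Rightarrow> ('o \<times> 'p, 'm \<times> 'n, 'q, 'k) fctr \<Rightarrow> 'p \<Rightarrow> ('o, 'm, 'q, 'k) fctr" where
  "fix_snd D F d = \<lparr>omap = (\<lambda>x. omap F (x, d)), amap = (\<lambda>f. amap F (f, Id D d))\<rparr>"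

definition is_nat_trans ::
  "('o, 'm, 'x) cat_scheme \<Rightarrow> ('p, 'n, 'y) cat_scheme \<Rightarrow>
    ('o, 'm, 'p, 'n) fctr \<Rightarrow> ('o, 'm, 'p, 'n) fctr \<Rightarrow> ('o \<Rightarrow> 'n) \<Rightarrow> bool" where
  "is_nat_trans C D F G t \<longleftrightarrow> is_functor C D F \<and> is_functor C D G \<and>
    (\<forall>x \<in> Ob C. t x \<in> hom D (omap F x) (omap G x)) \<and>
    (\<forall>x \<in> Ob C. \<forall>y \<in> Ob C. \<forall>f \<in> hom C x y. t y \<cdot>\<^bsub>D\<^esub> amap F f = amap G f \<cdot>\<^bsub>D\<^esub> t x)"

definition is_iso :: "('o, 'm, 'x) cat_scheme \<Rightarrow> 'm \<Rightarrow> bool" where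
  "is_iso C f \<longleftrightarrow> f \<in> Arr C \<and> (\<exists>g \<in> hom C (Cod C f) (Dom C f).
    g \<cdot>\<^bsub>C\<^esub> f = Id C (Dom C f) \<and> f \<cdot>\<^bsub>C\<^esub> g = Id C (Cod C f))"

definition is_nat_iso ::
  "('o, 'm, 'x) cat_scheme \<Rightarrow> ('p, 'n, 'y) cat_scheme \<Rightarrow>
    ('o, 'm, 'p, 'n) fctr \<Rightarrow> ('o, 'm, 'p, 'n) fctr \<Rightarrow> ('o \<Rightarrow> 'n) \<Rightarrow> bool" where
  "is_nat_iso C D F G t \<longleftrightarrow> is_nat_trans C D F G t \<and> (\<forall>x \<in> Ob C. is_iso D (t x))"

definition is_adjunction ::
  "('o, 'm, 'x) cat_scheme \<Rightarrow> ('p, 'n, 'y) cat_scheme \<Rightarrow>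
    ('o, 'm, 'p, 'n) fctr \<Rightarrow> ('p, 'n, 'o, 'm) fctr \<Rightarrow> ('p \<Rightarrow> 'n) \<Rightarrow> ('o \<Rightarrow> 'm) \<Rightarrow> bool" where
  "is_adjunction C D L R \<epsilon> \<eta> \<longleftrightarrow>
    is_functor C D L \<and> is_functor D C R \<and>
    is_nat_trans D D (L \<circ>\<^sub>f R) id_fctr \<epsilon> \<and>
    is_nat_trans C C id_fctr (R \<circ>\<^sub>f L) \<eta> \<and>
    (\<forall>x \<in> Ob C. \<epsilon> (omap L x) \<cdot>\<^bsub>D\<^esub> amap L (\<eta> x) = Id D (omap L x)) \<and>
    (\<forall>y \<in> Ob D. amap R (\<epsilon> y) \<cdot>\<^bsub>C\<^esub> \<eta> (omap R y) = Id C (omap R y))"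

section \<open>Extranatural transformations\<close>

definition is_extranat ::
  "('a, 'am, 'x) cat_scheme \<Rightarrow> ('b, 'bm, 'y) cat_scheme \<Rightarrow> ('c, 'cm, 'z) cat_scheme \<Rightarrow>
    ('d, 'dm, 'w) cat_scheme \<Rightarrow>
    ('c \<times> 'c \<times> 'a, 'cm \<times> 'cm \<times> 'am, 'd, 'dm) fctr \<Rightarrow>
    ('a \<times> 'b \<times> 'b, 'am \<times> 'bm \<times> 'bm, 'd, 'dm) fctr \<Rightarrow> ('c \<Rightarrow> 'a \<Rightarrow> 'b \<Rightarrow> 'dm) \<Rightarrow> bool" where
  "is_extranat A B C D P Q \<beta> \<longleftrightarrow>
    is_functor (prod_cat C (prod_cat (op_cat C) A)) D P \<and>
    is_functor (prod_cat A (prod_cat (op_cat B) B)) D Q \<and>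
    (\<forall>c \<in> Ob C. \<forall>a \<in> Ob A. \<forall>b \<in> Ob B. \<beta> c a b \<in> hom D (omap P (c, c, a)) (omap Q (a, b, b))) \<and>
    (\<forall>c \<in> Ob C. \<forall>c' \<in> Ob C. \<forall>f \<in> hom C c c'. \<forall>a \<in> Ob A. \<forall>b \<in> Ob B.
      \<beta> c' a b \<cdot>\<^bsub>D\<^esub> amap P (f, Id C c', Id A a) = \<beta> c a b \<cdot>\<^bsub>D\<^esub> amap P (Id C c, f, Id A a)) \<and>
    (\<forall>c \<in> Ob C. \<forall>a \<in> Ob A. \<forall>a' \<in> Ob A. \<forall>h \<in> hom A a a'. \<forall>b \<in> Ob B.
      \<beta> c a' b \<cdot>\<^bsub>D\<^esub> amap P (Id C c, Id C c, h) = amap Q (h, Id B b, Id B b) \<cdot>\<^bsub>D\<^esub> \<beta> c a b) \<and>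
    (\<forall>c \<in> Ob C. \<forall>a \<in> Ob A. \<forall>b \<in> Ob B. \<forall>b' \<in> Ob B. \<forall>g \<in> hom B b b'.
      amap Q (Id A a, g, Id B b') \<cdot>\<^bsub>D\<^esub> \<beta> c a b' = amap Q (Id A a, Id B b, g) \<cdot>\<^bsub>D\<^esub> \<beta> c a b)"

section \<open>Monoidal categories and left closed structures\<close>

record ('o, 'm) moncat = "('o, 'm) cat" +
  tensor :: "('o \<times> 'o, 'm \<times> 'm, 'o, 'm) fctr"
  unit_ob :: "'o"  ("\<one>\<index>")
  assoc :: "('o \<times> 'o) \<times> 'o \<Rightarrow> 'm"
  lunit :: "'o \<Rightarrow> 'm"
  runit :: "'o \<Rightarrow> 'm"

abbreviation tensor_ob :: "('o, 'm, 'x) moncat_scheme \<Rightarrow> 'o \<Rightarrow> 'o \<Rightarrow> 'o"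
  (infixr "\<otimes>\<index>" 75) where
  "x \<otimes>\<^bsub>C\<^esub> y \<equiv> omap (tensor C) (x, y)"

abbreviation tensor_arr :: "('o, 'm, 'x) moncat_scheme \<Rightarrow> 'm \<Rightarrow> 'm \<Rightarrow> 'm"
  (infixr "\<otimes>\<^sub>a\<index>" 75) where
  "f \<otimes>\<^sub>a\<^bsub>C\<^esub> g \<equiv> amap (tensor C) (f, g)"

locale monoidal_category = category C
  for C :: "('o, 'm, 'x) moncat_scheme" (structure) +
  assumes tensor: "is_functor (prod_cat C C) C (tensor C)"
    and unit_Ob: "\<one> \<in> Ob C"
    and assoc: "is_nat_iso (prod_cat (prod_cat C C) C) C
      (tensor C \<circ>\<^sub>f (tensor C \<times>\<^sub>f id_fctr)) (tensor C \<circ>\<^sub>f (id_fctr \<times>\<^sub>f tensor C) \<circ>\<^sub>f assoc_fctr)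
      (assoc C)"
    and lunit: "is_nat_iso C C (fix_fst C (tensor C) \<one>) id_fctr (lunit C)"
    and runit: "is_nat_iso C C (fix_snd C (tensor C) \<one>) id_fctr (runit C)"
    and pentagon: "\<lbrakk>w \<in> Ob C; x \<in> Ob C; y \<in> Ob C; z \<in> Ob C\<rbrakk> \<Longrightarrow>
      (Id C w \<otimes>\<^sub>a assoc C ((x, y), z)) \<cdot> assoc C ((w, x \<otimes> y), z) \<cdot> (assoc C ((w, x), y) \<otimes>\<^sub>a Id C z)
      = assoc C ((w, x), y \<otimes> z) \<cdot> assoc C ((w \<otimes> x, y), z)"
    and triangle: "\<lbrakk>x \<in> Ob C; y \<in> Ob C\<rbrakk> \<Longrightarrow>
      (Id C x \<otimes>\<^sub>a lunit C y) \<cdot> assoc C ((x, \<one>), y) = runit C x \<otimes>\<^sub>a Id C y"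

text \<open>
  A left closed structure assigns to each object \<open>c\<close> a triple \<open>([c, -], \<epsilon>\<^sub>c, \<eta>\<^sub>c)\<close> of the right
  adjoint, the counit and the unit. All functions involved are extensional, so that equality in HOL
  is equality of structures; likewise below.
\<close>
definition left_closed_structures ::
  "('o, 'm, 'x) moncat_scheme \<Rightarrow>
    ('o \<Rightarrow> ('o, 'm, 'o, 'm) fctr \<times> ('o \<Rightarrow> 'm) \<times> ('o \<Rightarrow> 'm)) set" where
  "left_closed_structures C = (\<Pi>\<^sub>E c \<in> Ob C. {(R, \<epsilon>, \<eta>).
    R \<in> functors C C \<and> \<epsilon> \<in> extensional (Ob C) \<and> \<eta> \<in> extensional (Ob C) \<and>
    is_adjunction C C (fix_fst C (tensor C) c) R \<epsilon> \<eta>})"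

text \<open>
  The triples \<open>(H, ev, coev)\<close>. The functors \<open>fst_fctr\<close> and \<open>snd_fctr \<circ>\<^sub>f snd_fctr\<close> are the
  identity functor of \<open>C\<close> regarded as a functor on \<open>C \<times> 1\<^sup>o\<^sup>p \<times> 1\<close> and \<open>1 \<times> 1\<^sup>o\<^sup>p \<times> C\<close>, and
  \<open>rotate_fctr\<close> permutes the factors so that the target of \<open>coev\<close> is \<open>(a, b, b') \<mapsto> H(b, b' \<otimes> a)\<close>.
\<close>
definition internal_hom_data ::
  "('o, 'm, 'x) moncat_scheme \<Rightarrow>
    (('o \<times> 'o, 'm \<times> 'm, 'o, 'm) fctr \<times> ('o \<times> 'o \<Rightarrow> 'm) \<times> ('o \<times> 'o \<Rightarrow> 'm)) set" where
  "internal_hom_data C = {(H, ev, coev).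
    H \<in> functors (prod_cat (op_cat C) C) C \<and>
    ev \<in> extensional (Ob C \<times> Ob C) \<and> coev \<in> extensional (Ob C \<times> Ob C) \<and>
    is_extranat C terminal_cat C C
      (tensor C \<circ>\<^sub>f (id_fctr \<times>\<^sub>f H)) fst_fctr (\<lambda>c a _. ev (c, a)) \<and>
    is_extranat C C terminal_cat C
      (snd_fctr \<circ>\<^sub>f snd_fctr) (H \<circ>\<^sub>f (id_fctr \<times>\<^sub>f tensor C) \<circ>\<^sub>f rotate_fctr) (\<lambda>_ a c. coev (c, a)) \<and>
    (\<forall>c \<in> Ob C. \<forall>a \<in> Ob C.
      amap H (Id C c, ev (c, a)) \<cdot>\<^bsub>C\<^esub> coev (c, omap H (c, a)) = Id C (omap H (c, a))) \<and>
    (\<forall>c \<in> Ob C. \<forall>a \<in> Ob C.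
      ev (c, c \<otimes>\<^bsub>C\<^esub> a) \<cdot>\<^bsub>C\<^esub> (Id C c \<otimes>\<^sub>a\<^bsub>C\<^esub> coev (c, a)) = Id C (c \<otimes>\<^bsub>C\<^esub> a))}"

definition closed_of_hom ::
  "('o, 'm, 'x) moncat_scheme \<Rightarrow>
    ('o \<times> 'o, 'm \<times> 'm, 'o, 'm) fctr \<times> ('o \<times> 'o \<Rightarrow> 'm) \<times> ('o \<times> 'o \<Rightarrow> 'm) \<Rightarrow>
    'o \<Rightarrow> ('o, 'm, 'o, 'm) fctr \<times> ('o \<Rightarrow> 'm) \<times> ('o \<Rightarrow> 'm)" where
  "closed_of_hom C = (\<lambda>(H, ev, coev). \<lambda>c \<in> Ob C.
    (\<lparr>omap = (\<lambda>a \<in> Ob C. omap H (c, a)), amap = (\<lambda>f \<in> Arr C. amap H (Id C c, f))\<rparr>,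
     (\<lambda>a \<in> Ob C. ev (c, a)), (\<lambda>a \<in> Ob C. coev (c, a))))"

end

theory Submission imports Defs begin

text \<open>
  The two notions differ only in how the internal hom acts on its contravariant argument: a left
  closed structure gives, for each object \<open>c\<close>, a functor \<open>[c, -]\<close>, while the data
  \<open>(H, ev, coev)\<close> also prescribe arrows \<open>H(f, a) : H(c', a) \<rightarrow> H(c, a)\<close> for \<open>f : c \<rightarrow> c'\<close>. The point is
  that these arrows exist and are unique once the adjunctions are given.

  Fixing \<open>c\<close>, functoriality of \<open>H\<close> in its second argument, naturality of \<open>ev\<close> and \<open>coev\<close> and the
  triangle identities say precisely that \<open>c \<otimes> - \<stileturn> H(c, -)\<close> with counit \<open>ev\<^sub>c\<close> and unit \<open>coev\<^sub>c\<close>, so that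
  the data yield a left closed structure. Extranaturality of the unit and one triangle identity
  force
  \<open>H(f, h) = H(c, h \<circ> ev\<^sub>c\<^sub>' \<circ> (f \<otimes> H(c', a))) \<circ> coev\<^sub>c\<close>
  (lemma \<open>hom_arr_determined\<close>), in which the right-hand side refers to \<open>H(c, -)\<close>, \<open>ev\<close> and \<open>coev\<close> only.
  Hence the assignment is injective.

  Conversely, given adjunctions \<open>c \<otimes> - \<stileturn> R\<^sub>c\<close> with counits \<open>\<epsilon>\<^sub>c\<close>, define \<open>H(f, h)\<close> by that formula. It is the
  transpose of an arrow out of \<open>c \<otimes> R\<^sub>c\<^sub>'(a)\<close>, so it is the unique arrow with
  \<open>\<epsilon>\<^sub>c \<circ> (c \<otimes> H(f, h)) = h \<circ> \<epsilon>\<^sub>c\<^sub>' \<circ> (f \<otimes> R\<^sub>c\<^sub>'(a))\<close>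
  (lemmas \<open>counit_H\<close> and \<open>eps_cancel\<close>). All remaining properties follow from this characterisation:
  with \<open>h\<close> an identity it is extranaturality of the counit, with \<open>f\<close> an identity it gives
  \<open>H(c, h) = R\<^sub>c(h)\<close>, and functoriality of \<open>H\<close> (\<open>H_amap_Comp\<close>) and extranaturality of the unit
  (\<open>unit_extranatural\<close>) are checked by composing both sides with the counit.
\<close>

section \<open>Categories and functors\<close>

context category begin

lemma hom_Ob: "f \<in> hom C x y \<Longrightarrow> x \<in> Ob C" "f \<in> hom C x y \<Longrightarrow> y \<in> Ob C"
  using Dom_Ob Cod_Ob by (auto simp: hom_def)

end

lemma Arr_hom: "f \<in> Arr C \<Longrightarrow> f \<in> hom C (Dom C f) (Cod C f)"
  by (simp add: hom_def)

lemma hom_op_cat [simp]: "hom (op_cat C) x y = hom C y x"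
  by (auto simp: hom_def op_cat_def)

lemma hom_prod_cat [simp]:
  "hom (prod_cat C D) x y = hom C (fst x) (fst y) \<times> hom D (snd x) (snd y)"
  by (cases x; cases y) (auto simp: hom_def prod_cat_def)

lemma op_cat_simps [simp]:
  "Ob (op_cat C) = Ob C" "Arr (op_cat C) = Arr C" "Id (op_cat C) = Id C"
  "Dom (op_cat C) = Cod C" "Cod (op_cat C) = Dom C" "g \<cdot>\<^bsub>op_cat C\<^esub> f = f \<cdot>\<^bsub>C\<^esub> g"
  by (simp_all add: op_cat_def)

lemma prod_cat_simps [simp]:
  "Ob (prod_cat C D) = Ob C \<times> Ob D" "Arr (prod_cat C D) = Arr C \<times> Arr D"
  "Dom (prod_cat C D) = map_prod (Dom C) (Dom D)" "Cod (prod_cat C D) = map_prod (Cod C) (Cod D)"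
  "Id (prod_cat C D) x = (Id C (fst x), Id D (snd x))"
  "p \<cdot>\<^bsub>prod_cat C D\<^esub> q = (fst p \<cdot>\<^bsub>C\<^esub> fst q, snd p \<cdot>\<^bsub>D\<^esub> snd q)"
  by (cases x; cases p; cases q; simp add: prod_cat_def)+

lemma terminal_cat_simps [simp]:
  "Ob terminal_cat = UNIV" "hom terminal_cat x y = UNIV"
  by (auto simp: terminal_cat_def hom_def)

lemma category_op:
  assumes "category C"
  shows "category (op_cat C)"
proof -
  interpret category C by fact
  show ?thesis
    by (rule category.intro) (auto simp: Dom_Ob Cod_Ob Id_hom Comp_Id Id_Comp Comp_assoc intro: Comp_hom)
qed

lemma category_prod:
  assumes "category C" "category D"
  shows "category (prod_cat C D)"
proof -
  interpret C: category C by fact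
  interpret D: category D by fact
  show ?thesis
    by (rule category.intro)
      (auto simp: C.Dom_Ob C.Cod_Ob C.Id_hom C.Comp_Id C.Id_Comp C.Comp_assoc
        D.Dom_Ob D.Cod_Ob D.Id_hom D.Comp_Id D.Id_Comp D.Comp_assoc intro: C.Comp_hom D.Comp_hom)
qed

lemma category_terminal: "category terminal_cat"
  by (rule category.intro) auto

lemma is_functor_category:
  assumes "is_functor C D F"
  shows "category C" "category D"
  using assms by (auto simp: is_functor_def)

lemma is_functorI:
  assumes "category C" "category D"
    and "\<And>x. x \<in> Ob C \<Longrightarrow> omap F x \<in> Ob D"
    and "\<And>x y f. f \<in> hom C x y \<Longrightarrow> amap F f \<in> hom D (omap F x) (omap F y)"
    and "\<And>x. x \<in> Ob C \<Longrightarrow> amap F (Id C x) = Id D (omap F x)"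
    and "\<And>x y z f g. f \<in> hom C x y \<Longrightarrow> g \<in> hom C y z \<Longrightarrow>
      amap F (g \<cdot>\<^bsub>C\<^esub> f) = amap F g \<cdot>\<^bsub>D\<^esub> amap F f"
  shows "is_functor C D F"
  using assms unfolding is_functor_def by blast

lemma functor_Ob: "is_functor C D F \<Longrightarrow> x \<in> Ob C \<Longrightarrow> omap F x \<in> Ob D"
  by (simp add: is_functor_def)

lemma functor_hom:
  "is_functor C D F \<Longrightarrow> f \<in> hom C x y \<Longrightarrow> amap F f \<in> hom D (omap F x) (omap F y)"
  unfolding is_functor_def by (meson category.hom_Ob)

lemma functor_Id: "is_functor C D F \<Longrightarrow> x \<in> Ob C \<Longrightarrow> amap F (Id C x) = Id D (omap F x)"
  by (simp add: is_functor_def)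

lemma functor_Comp:
  "is_functor C D F \<Longrightarrow> f \<in> hom C x y \<Longrightarrow> g \<in> hom C y z \<Longrightarrow>
    amap F (g \<cdot>\<^bsub>C\<^esub> f) = amap F g \<cdot>\<^bsub>D\<^esub> amap F f"
  unfolding is_functor_def by (meson category.hom_Ob)

lemma is_functor_id: "category C \<Longrightarrow> is_functor C C id_fctr"
  by (rule is_functorI) (auto simp: id_fctr_def)

lemma is_functor_fst: "category C \<Longrightarrow> category D \<Longrightarrow> is_functor (prod_cat C D) C fst_fctr"
  by (rule is_functorI) (auto simp: fst_fctr_def category_prod)

lemma is_functor_snd: "category C \<Longrightarrow> category D \<Longrightarrow> is_functor (prod_cat C D) D snd_fctr"
  by (rule is_functorI) (auto simp: snd_fctr_def category_prod)

lemma is_functor_comp: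
  assumes G: "is_functor D E G" and F: "is_functor C D F"
  shows "is_functor C E (G \<circ>\<^sub>f F)"
proof (rule is_functorI)
  show "category C" "category E" using assms is_functor_category by auto
  show "amap (G \<circ>\<^sub>f F) f \<in> hom E (omap (G \<circ>\<^sub>f F) x) (omap (G \<circ>\<^sub>f F) y)" if "f \<in> hom C x y" for x y f
    using functor_hom[OF G functor_hom[OF F that]] by (simp add: comp_fctr_def)
  show "amap (G \<circ>\<^sub>f F) (g \<cdot>\<^bsub>C\<^esub> f) = amap (G \<circ>\<^sub>f F) g \<cdot>\<^bsub>E\<^esub> amap (G \<circ>\<^sub>f F) f"
    if "f \<in> hom C x y" "g \<in> hom C y z" for x y z f g
    using functor_Comp[OF F that] functor_Comp[OF G functor_hom[OF F that(1)] functor_hom[OF F that(2)]]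
    by (simp add: comp_fctr_def)
qed (simp_all add: comp_fctr_def functor_Ob[OF F] functor_Ob[OF G] functor_Id[OF F] functor_Id[OF G])

lemma is_functor_prod:
  assumes F: "is_functor C C' F" and G: "is_functor D D' G"
  shows "is_functor (prod_cat C D) (prod_cat C' D') (F \<times>\<^sub>f G)"
proof (rule is_functorI)
  show "category (prod_cat C D)" "category (prod_cat C' D')"
    using assms by (auto intro: category_prod is_functor_category)
qed (auto simp: prod_fctr_def functor_Ob[OF F] functor_Ob[OF G] functor_Id[OF F] functor_Id[OF G]
    functor_Comp[OF F] functor_Comp[OF G] intro: functor_hom[OF F] functor_hom[OF G])

lemma is_functor_rotate:
  assumes "category C" "category D" "category E"
  shows "is_functor (prod_cat C (prod_cat D E)) (prod_cat D (prod_cat E C)) rotate_fctr"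
  by (rule is_functorI) (use assms in \<open>auto simp: rotate_fctr_def category_prod\<close>)

lemma is_functor_fix_fst:
  assumes "is_functor (prod_cat C D) E F" "category C" "category D" "c \<in> Ob C"
  shows "is_functor D E (fix_fst C F c)"
proof (rule is_functorI)
  have I: "Id C c \<in> hom C c c" "Id C c \<cdot>\<^bsub>C\<^esub> Id C c = Id C c"
    using assms category.Id_hom category.Comp_Id by metis+
  show "category D" "category E" using assms is_functor_category by auto
  show "omap (fix_fst C F c) x \<in> Ob E" if "x \<in> Ob D" for x
    using functor_Ob[OF assms(1), of "(c, x)"] that assms(4) by (simp add: fix_fst_def)
  show "amap (fix_fst C F c) f \<in> hom E (omap (fix_fst C F c) x) (omap (fix_fst C F c) y)"
    if "f \<in> hom D x y" for x y f
    using functor_hom[OF assms(1), of "(Id C c, f)" "(c, x)" "(c, y)"] that I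
    by (simp add: fix_fst_def)
  show "amap (fix_fst C F c) (Id D x) = Id E (omap (fix_fst C F c) x)" if "x \<in> Ob D" for x
    using functor_Id[OF assms(1), of "(c, x)"] that assms(4) by (simp add: fix_fst_def)
  show "amap (fix_fst C F c) (g \<cdot>\<^bsub>D\<^esub> f) = amap (fix_fst C F c) g \<cdot>\<^bsub>E\<^esub> amap (fix_fst C F c) f"
    if "f \<in> hom D x y" "g \<in> hom D y z" for x y z f g
    using functor_Comp[OF assms(1), of "(Id C c, f)" "(c, x)" "(c, y)" "(Id C c, g)" "(c, z)"] that I
    by (simp add: fix_fst_def)
qed

text \<open>
  Identities and composites are arrows of the domain again, so passing to the extensional
  representative preserves the functor laws.
\<close>
lemma is_functor_restrict:
  assumes F: "is_functor C D F"
  shows "is_functor C D \<lparr>omap = restrict (omap F) (Ob C), amap = restrict (amap F) (Arr C)\<rparr>"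
    (is "is_functor C D ?F")
proof (rule is_functorI)
  interpret category C using F by (rule is_functor_category)
  have A: "f \<in> Arr C" if "f \<in> hom C x y" for f x y using that by (simp add: hom_def)
  show "category C" "category D" using F by (auto intro: is_functor_category)
  show "omap ?F x \<in> Ob D" if "x \<in> Ob C" for x using that functor_Ob[OF F] by simp
  show "amap ?F f \<in> hom D (omap ?F x) (omap ?F y)" if "f \<in> hom C x y" for x y f
    using A[OF that] hom_Ob[OF that] functor_hom[OF F that] by simp
  show "amap ?F (Id C x) = Id D (omap ?F x)" if "x \<in> Ob C" for x
    using that A[OF Id_hom[OF that]] functor_Id[OF F] by simp
  show "amap ?F (g \<cdot>\<^bsub>C\<^esub> f) = amap ?F g \<cdot>\<^bsub>D\<^esub> amap ?F f"
    if "f \<in> hom C x y" "g \<in> hom C y z" for x y z f g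
    using A[OF that(1)] A[OF that(2)] A[OF Comp_hom[OF that]] functor_Comp[OF F that] by simp
qed

section \<open>Transposition along an adjunction\<close>

text \<open>
  The bijection \<open>D(L x, y) \<cong> C(x, R y)\<close> of an adjunction, from left to right; its inverse is
  \<open>v \<mapsto> \<epsilon>\<^sub>y \<circ> L v\<close>.
\<close>
definition transpose ::
  "('o, 'm, 'x) cat_scheme \<Rightarrow> ('p, 'n, 'o, 'm) fctr \<Rightarrow> ('o \<Rightarrow> 'm) \<Rightarrow> 'o \<Rightarrow> 'n \<Rightarrow> 'm" where
  "transpose C R \<eta> x u = amap R u \<cdot>\<^bsub>C\<^esub> \<eta> x"

context
  fixes C :: "('o, 'm, 'x) cat_scheme" and D :: "('p, 'n, 'y) cat_scheme" and L R \<epsilon> \<eta>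
  assumes adj: "is_adjunction C D L R \<epsilon> \<eta>"
begin

lemma adjunction_functors: "is_functor C D L" "is_functor D C R"
  using adj by (auto simp: is_adjunction_def)

lemma adjunction_categories: "category C" "category D"
  using is_functor_category[OF adjunction_functors(1)] by auto

lemma counit_hom: "y \<in> Ob D \<Longrightarrow> \<epsilon> y \<in> hom D (omap L (omap R y)) y"
  using adj by (auto simp: is_adjunction_def is_nat_trans_def comp_fctr_def id_fctr_def)

lemma unit_hom: "x \<in> Ob C \<Longrightarrow> \<eta> x \<in> hom C x (omap R (omap L x))"
  using adj by (auto simp: is_adjunction_def is_nat_trans_def comp_fctr_def id_fctr_def)

lemma counit_natural: "h \<in> hom D y y' \<Longrightarrow> \<epsilon> y' \<cdot>\<^bsub>D\<^esub> amap L (amap R h) = h \<cdot>\<^bsub>D\<^esub> \<epsilon> y"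
  using adj category.hom_Ob[OF adjunction_categories(2)]
  by (simp add: is_adjunction_def is_nat_trans_def comp_fctr_def id_fctr_def)

lemma unit_natural: "h \<in> hom C x x' \<Longrightarrow> \<eta> x' \<cdot>\<^bsub>C\<^esub> h = amap R (amap L h) \<cdot>\<^bsub>C\<^esub> \<eta> x"
  using adj category.hom_Ob[OF adjunction_categories(1)]
  by (simp add: is_adjunction_def is_nat_trans_def comp_fctr_def id_fctr_def)

lemma triangles:
  "x \<in> Ob C \<Longrightarrow> \<epsilon> (omap L x) \<cdot>\<^bsub>D\<^esub> amap L (\<eta> x) = Id D (omap L x)"
  "y \<in> Ob D \<Longrightarrow> amap R (\<epsilon> y) \<cdot>\<^bsub>C\<^esub> \<eta> (omap R y) = Id C (omap R y)"
  using adj by (auto simp: is_adjunction_def)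

lemma transpose_hom:
  assumes "x \<in> Ob C" "u \<in> hom D (omap L x) y"
  shows "transpose C R \<eta> x u \<in> hom C x (omap R y)"
  unfolding transpose_def using category.Comp_hom[OF adjunction_categories(1) unit_hom]
    functor_hom[OF adjunction_functors(2)] assms by blast

lemma counit_transpose:
  assumes x: "x \<in> Ob C" and u: "u \<in> hom D (omap L x) y"
  shows "\<epsilon> y \<cdot>\<^bsub>D\<^esub> amap L (transpose C R \<eta> x u) = u"
proof -
  interpret D: category D by (rule adjunction_categories)
  note RU = functor_hom[OF adjunction_functors(2) u]
  have y: "y \<in> Ob D" "omap L x \<in> Ob D" using D.hom_Ob[OF u] by auto
  have "\<epsilon> y \<cdot>\<^bsub>D\<^esub> amap L (transpose C R \<eta> x u) =
      \<epsilon> y \<cdot>\<^bsub>D\<^esub> (amap L (amap R u) \<cdot>\<^bsub>D\<^esub> amap L (\<eta> x))"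
    unfolding transpose_def
    using functor_Comp[OF adjunction_functors(1) unit_hom[OF x] RU] by simp
  also have "\<dots> = (\<epsilon> y \<cdot>\<^bsub>D\<^esub> amap L (amap R u)) \<cdot>\<^bsub>D\<^esub> amap L (\<eta> x)"
    using D.Comp_assoc functor_hom[OF adjunction_functors(1) unit_hom[OF x]]
      functor_hom[OF adjunction_functors(1) RU] counit_hom[OF y(1)] by metis
  also have "\<dots> = (u \<cdot>\<^bsub>D\<^esub> \<epsilon> (omap L x)) \<cdot>\<^bsub>D\<^esub> amap L (\<eta> x)"
    using counit_natural[OF u] by simp
  also have "\<dots> = u \<cdot>\<^bsub>D\<^esub> (\<epsilon> (omap L x) \<cdot>\<^bsub>D\<^esub> amap L (\<eta> x))"
    using D.Comp_assoc functor_hom[OF adjunction_functors(1) unit_hom[OF x]]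
      counit_hom[OF y(2)] u by metis
  also have "\<dots> = u" using triangles(1)[OF x] D.Comp_Id[OF u] by simp
  finally show ?thesis .
qed

lemma transpose_counit:
  assumes v: "v \<in> hom C x (omap R y)" and y: "y \<in> Ob D"
  shows "transpose C R \<eta> x (\<epsilon> y \<cdot>\<^bsub>D\<^esub> amap L v) = v"
proof -
  interpret C: category C by (rule adjunction_categories)
  have x: "x \<in> Ob C" "omap R y \<in> Ob C" using C.hom_Ob[OF v] by auto
  note LV = functor_hom[OF adjunction_functors(1) v]
  have "transpose C R \<eta> x (\<epsilon> y \<cdot>\<^bsub>D\<^esub> amap L v) =
      (amap R (\<epsilon> y) \<cdot>\<^bsub>C\<^esub> amap R (amap L v)) \<cdot>\<^bsub>C\<^esub> \<eta> x"
    unfolding transpose_def using functor_Comp[OF adjunction_functors(2) LV counit_hom[OF y]] by simp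
  also have "\<dots> = amap R (\<epsilon> y) \<cdot>\<^bsub>C\<^esub> (amap R (amap L v) \<cdot>\<^bsub>C\<^esub> \<eta> x)"
    using C.Comp_assoc[OF unit_hom[OF x(1)] functor_hom[OF adjunction_functors(2) LV]
        functor_hom[OF adjunction_functors(2) counit_hom[OF y]]] .
  also have "\<dots> = amap R (\<epsilon> y) \<cdot>\<^bsub>C\<^esub> (\<eta> (omap R y) \<cdot>\<^bsub>C\<^esub> v)"
    using unit_natural[OF v] by simp
  also have "\<dots> = (amap R (\<epsilon> y) \<cdot>\<^bsub>C\<^esub> \<eta> (omap R y)) \<cdot>\<^bsub>C\<^esub> v"
    using C.Comp_assoc[OF v unit_hom[OF x(2)]
        functor_hom[OF adjunction_functors(2) counit_hom[OF y]]] by simp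
  also have "\<dots> = v" using triangles(2)[OF y] C.Id_Comp[OF v] by simp
  finally show ?thesis .
qed

text \<open>
  The universal property of the counit, in the form in which equations between arrows into
  \<open>R y\<close> are verified below.
\<close>
lemma counit_cancel:
  assumes "v \<in> hom C x (omap R y)" "w \<in> hom C x (omap R y)" "y \<in> Ob D"
    and "\<epsilon> y \<cdot>\<^bsub>D\<^esub> amap L v = \<epsilon> y \<cdot>\<^bsub>D\<^esub> amap L w"
  shows "v = w"
  using transpose_counit[OF assms(1,3)] transpose_counit[OF assms(2,3)] assms(4) by metis

end

section \<open>Functors and extranatural transformations on a monoidal category\<close>

lemma omap_id [simp]: "omap id_fctr x = x" and amap_id [simp]: "amap id_fctr f = f"
  and omap_comp [simp]: "omap (G \<circ>\<^sub>f F) x = omap G (omap F x)"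
  and amap_comp [simp]: "amap (G \<circ>\<^sub>f F) f = amap G (amap F f)"
  for F :: "('o, 'm, 'p, 'n) fctr" and G :: "('p, 'n, 'q, 'k) fctr"
  by (simp_all add: id_fctr_def comp_fctr_def)

lemma fix_fst_simps [simp]:
  "omap (fix_fst C F c) y = omap F (c, y)" "amap (fix_fst C F c) g = amap F (Id C c, g)"
  by (simp_all add: fix_fst_def)

context monoidal_category begin

lemma is_category: "category C" ..

lemma tensor_Ob: "x \<in> Ob C \<Longrightarrow> y \<in> Ob C \<Longrightarrow> x \<otimes> y \<in> Ob C"
  using functor_Ob[OF tensor, of "(x, y)"] by simp

lemma tensor_hom: "f \<in> hom C x y \<Longrightarrow> g \<in> hom C x' y' \<Longrightarrow> f \<otimes>\<^sub>a g \<in> hom C (x \<otimes> x') (y \<otimes> y')"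
  using functor_hom[OF tensor, of "(f, g)" "(x, x')" "(y, y')"] by simp

lemma tensor_Id: "x \<in> Ob C \<Longrightarrow> y \<in> Ob C \<Longrightarrow> Id C x \<otimes>\<^sub>a Id C y = Id C (x \<otimes> y)"
  using functor_Id[OF tensor, of "(x, y)"] by simp

lemma tensor_Comp:
  "\<lbrakk>f \<in> hom C x y; g \<in> hom C y z; f' \<in> hom C x' y'; g' \<in> hom C y' z'\<rbrakk> \<Longrightarrow>
    (g \<cdot> f) \<otimes>\<^sub>a (g' \<cdot> f') = (g \<otimes>\<^sub>a g') \<cdot> (f \<otimes>\<^sub>a f')"
  using functor_Comp[OF tensor, of "(f, f')" "(x, x')" "(y, y')" "(g, g')" "(z, z')"] by simp

lemma tensor_slide:
  assumes f: "f \<in> hom C x y" and g: "g \<in> hom C x' y'"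
  shows "(f \<otimes>\<^sub>a Id C y') \<cdot> (Id C x \<otimes>\<^sub>a g) = (Id C y \<otimes>\<^sub>a g) \<cdot> (f \<otimes>\<^sub>a Id C x')"
  using tensor_Comp[OF Id_hom f g Id_hom] tensor_Comp[OF f Id_hom Id_hom g]
    hom_Ob[OF f] hom_Ob[OF g] Comp_Id[OF f] Id_Comp[OF f] Comp_Id[OF g] Id_Comp[OF g] by simp

lemma is_functor_tensor_left: "c \<in> Ob C \<Longrightarrow> is_functor C C (fix_fst C (tensor C) c)"
  using is_functor_fix_fst[OF tensor is_category is_category] .

end

locale internal_hom_functor = monoidal_category +
  fixes H
  assumes H: "is_functor (prod_cat (op_cat C) C) C H"
begin

lemma H_Ob: "c \<in> Ob C \<Longrightarrow> a \<in> Ob C \<Longrightarrow> omap H (c, a) \<in> Ob C"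
  using functor_Ob[OF H, of "(c, a)"] by simp

lemma H_hom:
  "f \<in> hom C c c' \<Longrightarrow> h \<in> hom C a a' \<Longrightarrow> amap H (f, h) \<in> hom C (omap H (c', a)) (omap H (c, a'))"
  using functor_hom[OF H, of "(f, h)" "(c', a)" "(c, a')"] by simp

lemma H_Id: "c \<in> Ob C \<Longrightarrow> a \<in> Ob C \<Longrightarrow> amap H (Id C c, Id C a) = Id C (omap H (c, a))"
  using functor_Id[OF H, of "(c, a)"] by simp

lemma H_Comp:
  "\<lbrakk>f \<in> hom C c c'; g \<in> hom C d c; h \<in> hom C a a'; k \<in> hom C a' a''\<rbrakk> \<Longrightarrow>
    amap H (f \<cdot> g, k \<cdot> h) = amap H (g, k) \<cdot> amap H (f, h)"
  using functor_Comp[OF H, of "(f, h)" "(c', a)" "(c, a')" "(g, k)" "(d, a'')"] by simp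

text \<open>
  Since the target of the counit is constant in the third category, which is terminal, extranaturality
  there is vacuous. What is left is extranaturality in \<open>c\<close> and naturality in \<open>a\<close>, with the identities
  \<open>H(c', a)\<close> evaluated.
\<close>
lemma is_extranat_ev_iff:
  "is_extranat C terminal_cat C C (tensor C \<circ>\<^sub>f (id_fctr \<times>\<^sub>f H)) fst_fctr (\<lambda>c a _. ev (c, a)) \<longleftrightarrow>
    (\<forall>c \<in> Ob C. \<forall>a \<in> Ob C. ev (c, a) \<in> hom C (c \<otimes> omap H (c, a)) a) \<and>
    (\<forall>c \<in> Ob C. \<forall>c' \<in> Ob C. \<forall>f \<in> hom C c c'. \<forall>a \<in> Ob C.
      ev (c', a) \<cdot> (f \<otimes>\<^sub>a Id C (omap H (c', a))) = ev (c, a) \<cdot> (Id C c \<otimes>\<^sub>a amap H (f, Id C a))) \<and>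
    (\<forall>c \<in> Ob C. \<forall>a \<in> Ob C. \<forall>a' \<in> Ob C. \<forall>h \<in> hom C a a'.
      ev (c, a') \<cdot> (Id C c \<otimes>\<^sub>a amap H (Id C c, h)) = h \<cdot> ev (c, a))"
proof -
  have "is_functor (prod_cat C (prod_cat (op_cat C) C)) C (tensor C \<circ>\<^sub>f (id_fctr \<times>\<^sub>f H))"
    by (intro is_functor_comp[OF tensor] is_functor_prod is_functor_id is_category H)
  moreover have "is_functor (prod_cat C (prod_cat (op_cat terminal_cat) terminal_cat)) C fst_fctr"
    by (intro is_functor_fst category_prod category_op category_terminal is_category)
  ultimately show ?thesis
    by (simp add: is_extranat_def prod_fctr_def fst_fctr_def H_Id)
qed

text \<open>
  Dually, the source of the unit is constant in the first category, which is terminal, and only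
  naturality in \<open>a\<close> and extranaturality in \<open>c\<close> remain.
\<close>
lemma is_extranat_coev_iff:
  "is_extranat C C terminal_cat C (snd_fctr \<circ>\<^sub>f snd_fctr)
      (H \<circ>\<^sub>f (id_fctr \<times>\<^sub>f tensor C) \<circ>\<^sub>f rotate_fctr) (\<lambda>_ a c. coev (c, a)) \<longleftrightarrow>
    (\<forall>a \<in> Ob C. \<forall>c \<in> Ob C. coev (c, a) \<in> hom C a (omap H (c, c \<otimes> a))) \<and>
    (\<forall>a \<in> Ob C. \<forall>a' \<in> Ob C. \<forall>h \<in> hom C a a'. \<forall>c \<in> Ob C.
      coev (c, a') \<cdot> h = amap H (Id C c, Id C c \<otimes>\<^sub>a h) \<cdot> coev (c, a)) \<and>
    (\<forall>a \<in> Ob C. \<forall>c \<in> Ob C. \<forall>c' \<in> Ob C. \<forall>g \<in> hom C c c'.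
      amap H (g, Id C (c' \<otimes> a)) \<cdot> coev (c', a) = amap H (Id C c, g \<otimes>\<^sub>a Id C a) \<cdot> coev (c, a))"
proof -
  have "is_functor (prod_cat terminal_cat (prod_cat (op_cat terminal_cat) C)) C
      (snd_fctr \<circ>\<^sub>f snd_fctr)"
    by (intro is_functor_comp[OF is_functor_snd[of "op_cat terminal_cat"] is_functor_snd]
        category_prod category_op category_terminal is_category)
  moreover have "is_functor (prod_cat C (prod_cat (op_cat C) C)) C
      (H \<circ>\<^sub>f (id_fctr \<times>\<^sub>f tensor C) \<circ>\<^sub>f rotate_fctr)"
    by (intro is_functor_comp[OF H] is_functor_comp[OF _ is_functor_rotate] is_functor_prod
        is_functor_id category_op is_category tensor)
  ultimately show ?thesis
    by (simp add: is_extranat_def prod_fctr_def snd_fctr_def rotate_fctr_def tensor_Id)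
qed

end

section \<open>From internal homs to left closed structures\<close>

locale internal_hom = internal_hom_functor +
  fixes ev coev
  assumes data: "(H, ev, coev) \<in> internal_hom_data C"
begin

lemma
  shows ev_hom: "c \<in> Ob C \<Longrightarrow> a \<in> Ob C \<Longrightarrow> ev (c, a) \<in> hom C (c \<otimes> omap H (c, a)) a"
    and ev_natural: "c \<in> Ob C \<Longrightarrow> h \<in> hom C a a' \<Longrightarrow>
      ev (c, a') \<cdot> (Id C c \<otimes>\<^sub>a amap H (Id C c, h)) = h \<cdot> ev (c, a)"
    and coev_hom: "c \<in> Ob C \<Longrightarrow> a \<in> Ob C \<Longrightarrow> coev (c, a) \<in> hom C a (omap H (c, c \<otimes> a))"
    and coev_natural: "c \<in> Ob C \<Longrightarrow> h \<in> hom C a a' \<Longrightarrow>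
      coev (c, a') \<cdot> h = amap H (Id C c, Id C c \<otimes>\<^sub>a h) \<cdot> coev (c, a)"
    and coev_extranatural: "g \<in> hom C c c' \<Longrightarrow> a \<in> Ob C \<Longrightarrow>
      amap H (g, Id C (c' \<otimes> a)) \<cdot> coev (c', a) = amap H (Id C c, g \<otimes>\<^sub>a Id C a) \<cdot> coev (c, a)"
    and ev_coev: "c \<in> Ob C \<Longrightarrow> a \<in> Ob C \<Longrightarrow>
      amap H (Id C c, ev (c, a)) \<cdot> coev (c, omap H (c, a)) = Id C (omap H (c, a))"
    and coev_ev: "c \<in> Ob C \<Longrightarrow> a \<in> Ob C \<Longrightarrow>
      ev (c, c \<otimes> a) \<cdot> (Id C c \<otimes>\<^sub>a coev (c, a)) = Id C (c \<otimes> a)"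
  using data hom_Ob
  by (auto simp: internal_hom_data_def is_extranat_ev_iff is_extranat_coev_iff)

text \<open>
  This is why the assignment is injective: the action of \<open>H\<close> on all arrows can be recovered from the
  functors \<open>H(c, -)\<close>, the counits and the units. Extranaturality of the unit moves \<open>f\<close> from the tensor
  product into the contravariant argument of \<open>H\<close>, whereupon the counit meets the unit at \<open>c'\<close> instead
  of \<open>c\<close> and cancels with it by a triangle identity.
\<close>
lemma hom_arr_determined:
  assumes f: "f \<in> hom C c c'" and h: "h \<in> hom C a a'"
  shows "amap H (f, h) =
    amap H (Id C c, h \<cdot> ev (c', a) \<cdot> (f \<otimes>\<^sub>a Id C (omap H (c', a)))) \<cdot> coev (c, omap H (c', a))"
proof -
  have O: "c \<in> Ob C" "c' \<in> Ob C" "a \<in> Ob C" "a' \<in> Ob C" using hom_Ob f h by auto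
  define x where "x = omap H (c', a)"
  have x: "x \<in> Ob C" unfolding x_def using H_Ob O by simp
  have e: "ev (c', a) \<in> hom C (c' \<otimes> x) a" unfolding x_def using ev_hom O by simp
  have he: "h \<cdot> ev (c', a) \<in> hom C (c' \<otimes> x) a'" using Comp_hom[OF e h] .
  have t: "f \<otimes>\<^sub>a Id C x \<in> hom C (c \<otimes> x) (c' \<otimes> x)" using tensor_hom[OF f Id_hom[OF x]] .
  have I: "Id C (c' \<otimes> x) \<in> hom C (c' \<otimes> x) (c' \<otimes> x)" using Id_hom tensor_Ob O x by simp
  note Ic = Id_hom[OF O(1)] and Ic' = Id_hom[OF O(2)]
  have "amap H (Id C c, h \<cdot> ev (c', a) \<cdot> (f \<otimes>\<^sub>a Id C x)) \<cdot> coev (c, x) =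
      amap H (Id C c \<cdot> Id C c, (h \<cdot> ev (c', a)) \<cdot> (f \<otimes>\<^sub>a Id C x)) \<cdot> coev (c, x)"
    using Comp_assoc[OF t e h] Comp_Id[OF Ic] by simp
  also have "\<dots> = amap H (Id C c, h \<cdot> ev (c', a)) \<cdot> (amap H (Id C c, f \<otimes>\<^sub>a Id C x) \<cdot> coev (c, x))"
    using H_Comp[OF Ic Ic t he] Comp_assoc[OF coev_hom[OF O(1) x] H_hom[OF Ic t] H_hom[OF Ic he]]
    by simp
  also have "\<dots> = amap H (Id C c, h \<cdot> ev (c', a)) \<cdot> (amap H (f, Id C (c' \<otimes> x)) \<cdot> coev (c', x))"
    using coev_extranatural[OF f x] by simp
  also have "\<dots> = amap H (f \<cdot> Id C c, (h \<cdot> ev (c', a)) \<cdot> Id C (c' \<otimes> x)) \<cdot> coev (c', x)"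
    using H_Comp[OF f Ic I he] Comp_assoc[OF coev_hom[OF O(2) x] H_hom[OF f I] H_hom[OF Ic he]]
    by simp
  also have "\<dots> = amap H (Id C c' \<cdot> f, h \<cdot> ev (c', a)) \<cdot> coev (c', x)"
    using Comp_Id[OF f] Id_Comp[OF f] Comp_Id[OF he] by simp
  also have "\<dots> = amap H (f, h) \<cdot> (amap H (Id C c', ev (c', a)) \<cdot> coev (c', x))"
    using H_Comp[OF Ic' f e h] Comp_assoc[OF coev_hom[OF O(2) x] H_hom[OF Ic' e] H_hom[OF f h]]
    by simp
  also have "\<dots> = amap H (f, h)"
    using ev_coev[OF O(2,3)] Comp_Id[OF H_hom[OF f h]] by (simp add: x_def)
  finally show ?thesis by (simp add: x_def)
qed

lemma is_functor_hom_right: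
  assumes c: "c \<in> Ob C"
  shows "is_functor C C \<lparr>omap = (\<lambda>a \<in> Ob C. omap H (c, a)), amap = (\<lambda>f \<in> Arr C. amap H (Id C c, f))\<rparr>"
proof -
  have "is_functor C C (fix_fst (op_cat C) H c)"
    using is_functor_fix_fst[OF H category_op[OF is_category] is_category] c by simp
  from is_functor_restrict[OF this] show ?thesis by (simp add: fix_fst_def)
qed

lemma is_adjunction_hom_right:
  assumes c: "c \<in> Ob C"
  shows "is_adjunction C C (fix_fst C (tensor C) c)
    \<lparr>omap = (\<lambda>a \<in> Ob C. omap H (c, a)), amap = (\<lambda>f \<in> Arr C. amap H (Id C c, f))\<rparr>
    (\<lambda>a \<in> Ob C. ev (c, a)) (\<lambda>a \<in> Ob C. coev (c, a))" (is "is_adjunction C C ?L ?R ?\<epsilon> ?\<eta>")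
proof -
  note L = is_functor_tensor_left[OF c] and R = is_functor_hom_right[OF c]
  have A: "f \<in> Arr C" if "f \<in> hom C x y" for f x y using that by (simp add: hom_def)
  have "is_nat_trans C C (?L \<circ>\<^sub>f ?R) id_fctr ?\<epsilon>"
    using is_functor_comp[OF L R] is_functor_id[OF is_category] c
    by (auto simp: is_nat_trans_def ev_hom ev_natural A)
  moreover have "is_nat_trans C C id_fctr (?R \<circ>\<^sub>f ?L) ?\<eta>"
    using is_functor_comp[OF R L] is_functor_id[OF is_category] c
    by (auto simp: is_nat_trans_def tensor_Ob coev_hom coev_natural A[OF tensor_hom[OF Id_hom[OF c]]])
  ultimately show ?thesis
    using L R c by (simp add: is_adjunction_def tensor_Ob H_Ob coev_ev ev_coev A[OF ev_hom])
qed

end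

lemma internal_homI:
  assumes "monoidal_category C" and "(H, ev, coev) \<in> internal_hom_data C"
  shows "internal_hom C H ev coev"
proof -
  interpret monoidal_category C by fact
  show ?thesis
    by unfold_locales (use assms(2) in \<open>auto simp: internal_hom_data_def functors_def\<close>)
qed

lemma closed_of_hom_left_closed:
  assumes C: "monoidal_category C" and "d \<in> internal_hom_data C"
  shows "closed_of_hom C d \<in> left_closed_structures C"
proof -
  obtain H ev coev where d: "d = (H, ev, coev)" by (cases d)
  interpret internal_hom C H ev coev using internal_homI C assms(2) d by blast
  show ?thesis
    unfolding d closed_of_hom_def left_closed_structures_def
    by (auto simp: functors_def is_functor_hom_right is_adjunction_hom_right)
qed

section \<open>From left closed structures to internal homs\<close>

text \<open>
  The arrow part is the formula of \<open>hom_arr_determined\<close>, with the source and target of \<open>f\<close> and the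
  source of \<open>h\<close> read off from the arrows.
\<close>
definition hom_of_closed ::
  "('o, 'm, 'x) moncat_scheme \<Rightarrow> ('o \<Rightarrow> ('o, 'm, 'o, 'm) fctr \<times> ('o \<Rightarrow> 'm) \<times> ('o \<Rightarrow> 'm)) \<Rightarrow>
    ('o \<times> 'o, 'm \<times> 'm, 'o, 'm) fctr \<times> ('o \<times> 'o \<Rightarrow> 'm) \<times> ('o \<times> 'o \<Rightarrow> 'm)" where
  "hom_of_closed C S = (let R = (\<lambda>c. fst (S c)); \<epsilon> = (\<lambda>c. fst (snd (S c))); \<eta> = (\<lambda>c. snd (snd (S c))) in
    (\<lparr>omap = (\<lambda>(c, a) \<in> Ob C \<times> Ob C. omap (R c) a),
      amap = (\<lambda>(f, h) \<in> Arr C \<times> Arr C.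
        let c = Dom C f; c' = Cod C f; a = Dom C h in
        transpose C (R c) (\<eta> c) (omap (R c') a)
          (h \<cdot>\<^bsub>C\<^esub> \<epsilon> c' a \<cdot>\<^bsub>C\<^esub> (f \<otimes>\<^sub>a\<^bsub>C\<^esub> Id C (omap (R c') a))))\<rparr>,
     (\<lambda>(c, a) \<in> Ob C \<times> Ob C. \<epsilon> c a), (\<lambda>(c, a) \<in> Ob C \<times> Ob C. \<eta> c a)))"

text \<open>Only the arrow part of \<open>H\<close> is not immediate; there the claim is \<open>hom_arr_determined\<close>.\<close>
lemma hom_of_closed_of_hom:
  assumes C: "monoidal_category C" and "d \<in> internal_hom_data C"
  shows "hom_of_closed C (closed_of_hom C d) = d"
proof -
  obtain H ev coev where d: "d = (H, ev, coev)" by (cases d)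
  interpret internal_hom C H ev coev using internal_homI C assms(2) d by blast
  have ext: "omap H \<in> extensional (Ob C \<times> Ob C)" "amap H \<in> extensional (Arr C \<times> Arr C)"
    "ev \<in> extensional (Ob C \<times> Ob C)" "coev \<in> extensional (Ob C \<times> Ob C)"
    using data by (auto simp: internal_hom_data_def functors_def)
  obtain H' ev' coev' where h': "hom_of_closed C (closed_of_hom C d) = (H', ev', coev')"
    by (cases "hom_of_closed C (closed_of_hom C d)")
  note defs = h'[unfolded d hom_of_closed_def closed_of_hom_def transpose_def Let_def, simplified]
  have "omap H' = omap H"
    by (rule extensionalityI[OF _ ext(1)]) (use defs in auto)
  moreover have "ev' = ev"
    by (rule extensionalityI[OF _ ext(3)]) (use defs in auto)
  moreover have "coev' = coev"
    by (rule extensionalityI[OF _ ext(4)]) (use defs in auto)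
  moreover have "amap H' = amap H"
  proof (rule extensionalityI[OF _ ext(2)])
    show "amap H' \<in> extensional (Arr C \<times> Arr C)" using defs by auto
    fix p assume "p \<in> Arr C \<times> Arr C"
    then obtain f h where p: "p = (f, h)" and A: "f \<in> Arr C" "h \<in> Arr C" by auto
    note f = Arr_hom[OF A(1)] and h = Arr_hom[OF A(2)]
    have O: "Dom C f \<in> Ob C" "Cod C f \<in> Ob C" "Dom C h \<in> Ob C" using A Dom_Ob Cod_Ob by auto
    have "h \<cdot>\<^bsub>C\<^esub> ev (Cod C f, Dom C h) \<cdot>\<^bsub>C\<^esub> (f \<otimes>\<^sub>a\<^bsub>C\<^esub> Id C (omap H (Cod C f, Dom C h))) \<in> Arr C"
      using Comp_hom[OF Comp_hom[OF tensor_hom[OF f Id_hom[OF H_Ob[OF O(2,3)]]] ev_hom[OF O(2,3)]] h]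
      by (simp add: hom_def)
    then show "amap H' p = amap H p"
      using defs hom_arr_determined[OF f h] A O by (auto simp: p H_Ob)
  qed
  ultimately have "H' = H" "ev' = ev" "coev' = coev" by (cases H; cases H'; simp)+
  with h' d show ?thesis by simp
qed

locale left_closed_category = monoidal_category +
  fixes S
  assumes S: "S \<in> left_closed_structures C"
begin

abbreviation "R c \<equiv> fst (S c)"
abbreviation "\<epsilon> c \<equiv> fst (snd (S c))"
abbreviation "\<eta> c \<equiv> snd (snd (S c))"
abbreviation "H \<equiv> fst (hom_of_closed C S)"

lemma
  assumes "c \<in> Ob C"
  shows adj: "is_adjunction C C (fix_fst C (tensor C) c) (R c) (\<epsilon> c) (\<eta> c)"
    and R_functors: "R c \<in> functors C C"
    and counit_extensional: "\<epsilon> c \<in> extensional (Ob C)"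
    and unit_extensional: "\<eta> c \<in> extensional (Ob C)"
  using PiE_mem[OF S[unfolded left_closed_structures_def] assms] by (simp_all add: case_prod_beta)

lemma R_Ob: "c \<in> Ob C \<Longrightarrow> a \<in> Ob C \<Longrightarrow> omap (R c) a \<in> Ob C"
  by (rule functor_Ob[OF adjunction_functors(2)[OF adj]])

lemma R_hom: "c \<in> Ob C \<Longrightarrow> h \<in> hom C a a' \<Longrightarrow> amap (R c) h \<in> hom C (omap (R c) a) (omap (R c) a')"
  by (rule functor_hom[OF adjunction_functors(2)[OF adj]])

lemma eps_hom: "c \<in> Ob C \<Longrightarrow> a \<in> Ob C \<Longrightarrow> \<epsilon> c a \<in> hom C (c \<otimes> omap (R c) a) a"
  using counit_hom[OF adj] by simp

lemma eta_hom: "c \<in> Ob C \<Longrightarrow> a \<in> Ob C \<Longrightarrow> \<eta> c a \<in> hom C a (omap (R c) (c \<otimes> a))"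
  using unit_hom[OF adj] by simp

lemma eps_cancel:
  assumes "c \<in> Ob C" "y \<in> Ob C" "v \<in> hom C x (omap (R c) y)" "w \<in> hom C x (omap (R c) y)"
    and "\<epsilon> c y \<cdot> (Id C c \<otimes>\<^sub>a v) = \<epsilon> c y \<cdot> (Id C c \<otimes>\<^sub>a w)"
  shows "v = w"
  by (rule counit_cancel[OF adj[OF assms(1)] assms(3,4,2)]) (simp add: assms(5))

lemma H_omap: "c \<in> Ob C \<Longrightarrow> a \<in> Ob C \<Longrightarrow> omap H (c, a) = omap (R c) a"
  by (simp add: hom_of_closed_def)

text \<open>
  Together with \<open>eps_cancel\<close>, the equation \<open>counit_H\<close> characterises \<open>H(f, h)\<close>. Every later property of
  \<open>H\<close> is derived from it, without unfolding the definition.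
\<close>
lemma
  assumes f: "f \<in> hom C c c'" and h: "h \<in> hom C a a'"
  shows H_amap_hom: "amap H (f, h) \<in> hom C (omap (R c') a) (omap (R c) a')"
    and counit_H: "\<epsilon> c a' \<cdot> (Id C c \<otimes>\<^sub>a amap H (f, h)) =
      h \<cdot> \<epsilon> c' a \<cdot> (f \<otimes>\<^sub>a Id C (omap (R c') a))"
proof -
  have O: "c \<in> Ob C" "c' \<in> Ob C" "a \<in> Ob C" "a' \<in> Ob C" using hom_Ob f h by auto
  have fh: "f \<in> Arr C" "Dom C f = c" "Cod C f = c'" "h \<in> Arr C" "Dom C h = a"
    using f h by (auto simp: hom_def)
  let ?x = "omap (R c') a"
  let ?u = "h \<cdot> \<epsilon> c' a \<cdot> (f \<otimes>\<^sub>a Id C ?x)"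
  have x: "?x \<in> Ob C" using R_Ob O by simp
  have u: "?u \<in> hom C (omap (fix_fst C (tensor C) c) ?x) a'"
    using Comp_hom[OF Comp_hom[OF tensor_hom[OF f Id_hom[OF x]] eps_hom[OF O(2,3)]] h] by simp
  have eq: "amap H (f, h) = transpose C (R c) (\<eta> c) ?x ?u"
    using fh by (simp add: hom_of_closed_def Let_def)
  show "amap H (f, h) \<in> hom C ?x (omap (R c) a')"
    unfolding eq by (rule transpose_hom[OF adj[OF O(1)] x u])
  show "\<epsilon> c a' \<cdot> (Id C c \<otimes>\<^sub>a amap H (f, h)) = ?u"
    unfolding eq using counit_transpose[OF adj[OF O(1)] x u] by simp
qed

lemma H_Id_left:
  assumes c: "c \<in> Ob C" and h: "h \<in> hom C a a'"
  shows "amap H (Id C c, h) = amap (R c) h"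
proof (rule eps_cancel[OF c hom_Ob(2)[OF h] H_amap_hom[OF Id_hom[OF c] h] R_hom[OF c h]])
  have a: "a \<in> Ob C" using hom_Ob h by simp
  show "\<epsilon> c a' \<cdot> (Id C c \<otimes>\<^sub>a amap H (Id C c, h)) = \<epsilon> c a' \<cdot> (Id C c \<otimes>\<^sub>a amap (R c) h)"
    using counit_H[OF Id_hom[OF c] h] counit_natural[OF adj[OF c] h] tensor_Id[OF c R_Ob[OF c a]]
      Comp_Id[OF eps_hom[OF c a]] by simp
qed

text \<open>
  By the characterisation it suffices to compare both sides after composing with the counit. There
  \<open>g \<otimes> -\<close> slides past \<open>- \<otimes> H(f, h)\<close> by the interchange law, so that \<open>counit_H\<close> applies once for \<open>(g, k)\<close>
  and once for \<open>(f, h)\<close>.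
\<close>
lemma H_amap_Comp:
  assumes f: "f \<in> hom C c c'" and g: "g \<in> hom C d c" and h: "h \<in> hom C a a'" and k: "k \<in> hom C a' a''"
  shows "amap H (f \<cdot> g, k \<cdot> h) = amap H (g, k) \<cdot> amap H (f, h)"
proof -
  have O: "c \<in> Ob C" "c' \<in> Ob C" "d \<in> Ob C" "a \<in> Ob C" "a' \<in> Ob C" "a'' \<in> Ob C"
    using hom_Ob f g h k by auto
  let ?x = "omap (R c') a"
  let ?y = "omap (R c) a'"
  have x: "?x \<in> Ob C" and y: "?y \<in> Ob C" using R_Ob O by auto
  note Hfh = H_amap_hom[OF f h] and Hgk = H_amap_hom[OF g k]
  note Id = Id_hom[OF O(3)] and Ix = Id_hom[OF x] and Iy = Id_hom[OF y]
  note dHfh = tensor_hom[OF Id Hfh] and dHgk = tensor_hom[OF Id Hgk]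
  note cHfh = tensor_hom[OF Id_hom[OF O(1)] Hfh]
  note gx = tensor_hom[OF g Ix] and gy = tensor_hom[OF g Iy] and fx = tensor_hom[OF f Ix]
  note e = eps_hom[OF O(1,5)] and e' = eps_hom[OF O(2,4)]
  have "\<epsilon> d a'' \<cdot> (Id C d \<otimes>\<^sub>a (amap H (g, k) \<cdot> amap H (f, h))) =
      \<epsilon> d a'' \<cdot> ((Id C d \<otimes>\<^sub>a amap H (g, k)) \<cdot> (Id C d \<otimes>\<^sub>a amap H (f, h)))"
    using tensor_Comp[OF Id Id Hfh Hgk] Comp_Id[OF Id] by simp
  also have "\<dots> = (k \<cdot> \<epsilon> c a' \<cdot> (g \<otimes>\<^sub>a Id C ?y)) \<cdot> (Id C d \<otimes>\<^sub>a amap H (f, h))"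
    using Comp_assoc[OF dHfh dHgk eps_hom[OF O(3,6)]] counit_H[OF g k] by simp
  also have "\<dots> = k \<cdot> \<epsilon> c a' \<cdot> ((g \<otimes>\<^sub>a Id C ?y) \<cdot> (Id C d \<otimes>\<^sub>a amap H (f, h)))"
    using Comp_assoc[OF dHfh Comp_hom[OF gy e] k] Comp_assoc[OF dHfh gy e] by simp
  also have "\<dots> = k \<cdot> \<epsilon> c a' \<cdot> ((Id C c \<otimes>\<^sub>a amap H (f, h)) \<cdot> (g \<otimes>\<^sub>a Id C ?x))"
    using tensor_slide[OF g Hfh] by simp
  also have "\<dots> = k \<cdot> (h \<cdot> \<epsilon> c' a \<cdot> (f \<otimes>\<^sub>a Id C ?x)) \<cdot> (g \<otimes>\<^sub>a Id C ?x)"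
    using Comp_assoc[OF gx cHfh e] counit_H[OF f h] by simp
  also have "\<dots> = k \<cdot> h \<cdot> \<epsilon> c' a \<cdot> ((f \<otimes>\<^sub>a Id C ?x) \<cdot> (g \<otimes>\<^sub>a Id C ?x))"
    using Comp_assoc[OF gx Comp_hom[OF fx e'] h] Comp_assoc[OF gx fx e'] by simp
  also have "\<dots> = (k \<cdot> h) \<cdot> \<epsilon> c' a \<cdot> ((f \<cdot> g) \<otimes>\<^sub>a Id C ?x)"
    using tensor_Comp[OF g f Ix Ix] Comp_Id[OF Ix]
      Comp_assoc[OF Comp_hom[OF Comp_hom[OF gx fx] e'] h k] by simp
  also have "\<dots> = \<epsilon> d a'' \<cdot> (Id C d \<otimes>\<^sub>a amap H (f \<cdot> g, k \<cdot> h))"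
    using counit_H[OF Comp_hom[OF g f] Comp_hom[OF h k]] by simp
  finally show ?thesis
    by (rule eps_cancel[OF O(3,6) Comp_hom[OF Hfh Hgk]
          H_amap_hom[OF Comp_hom[OF g f] Comp_hom[OF h k]], symmetric])
qed

lemma H_functor: "is_functor (prod_cat (op_cat C) C) C H"
proof (rule is_functorI)
  show "category (prod_cat (op_cat C) C)" "category C"
    by (intro category_prod category_op is_category)+
  show "omap H p \<in> Ob C" if "p \<in> Ob (prod_cat (op_cat C) C)" for p
    using that by (auto simp: H_omap R_Ob)
  show "amap H m \<in> hom C (omap H p) (omap H q)" if "m \<in> hom (prod_cat (op_cat C) C) p q" for p q m
    using that hom_Ob by (cases p; cases q) (auto simp: H_omap intro!: H_amap_hom)
  show "amap H (Id (prod_cat (op_cat C) C) p) = Id C (omap H p)"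
    if "p \<in> Ob (prod_cat (op_cat C) C)" for p
    using that
    by (auto simp: H_omap H_Id_left[OF _ Id_hom] functor_Id[OF adjunction_functors(2)[OF adj]])
  show "amap H (n \<cdot>\<^bsub>prod_cat (op_cat C) C\<^esub> m) = amap H n \<cdot> amap H m"
    if "m \<in> hom (prod_cat (op_cat C) C) p q" "n \<in> hom (prod_cat (op_cat C) C) q r" for p q r m n
    using that by (auto intro: H_amap_Comp)
qed

sublocale internal_hom_functor C H
  by unfold_locales (rule H_functor)

text \<open>
  Both sides are the transpose of \<open>g \<otimes> a\<close>: the right-hand side because \<open>H(c, -) = R\<^sub>c\<close>, the
  left-hand side because after composition with the counit at \<open>c\<close> the arrow \<open>g\<close> slides to the right of the
  unit, leaving the triangle identity at \<open>c'\<close>.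
\<close>
lemma unit_extranatural:
  assumes g: "g \<in> hom C c c'" and a: "a \<in> Ob C"
  shows "amap H (g, Id C (c' \<otimes> a)) \<cdot> \<eta> c' a = amap H (Id C c, g \<otimes>\<^sub>a Id C a) \<cdot> \<eta> c a"
proof -
  have O: "c \<in> Ob C" "c' \<in> Ob C" "c \<otimes> a \<in> Ob C" "c' \<otimes> a \<in> Ob C" using hom_Ob g a tensor_Ob by auto
  let ?x = "omap (R c') (c' \<otimes> a)"
  note x = R_Ob[OF O(2,4)]
  note ga = tensor_hom[OF g Id_hom[OF a]] and Ic = Id_hom[OF O(1)]
  have ga': "g \<otimes>\<^sub>a Id C a \<in> hom C (omap (fix_fst C (tensor C) c) a) (c' \<otimes> a)" using ga by simp
  note e = eps_hom[OF O(2,4)] and Hg = H_amap_hom[OF g Id_hom[OF O(4)]] and n = eta_hom[OF O(2) a]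
  note gx = tensor_hom[OF g Id_hom[OF x]]
  have t: "amap H (Id C c, g \<otimes>\<^sub>a Id C a) \<cdot> \<eta> c a = transpose C (R c) (\<eta> c) a (g \<otimes>\<^sub>a Id C a)"
    using H_Id_left[OF O(1) ga] by (simp add: transpose_def)
  have "\<epsilon> c (c' \<otimes> a) \<cdot> (Id C c \<otimes>\<^sub>a (amap H (g, Id C (c' \<otimes> a)) \<cdot> \<eta> c' a)) =
      (\<epsilon> c (c' \<otimes> a) \<cdot> (Id C c \<otimes>\<^sub>a amap H (g, Id C (c' \<otimes> a)))) \<cdot> (Id C c \<otimes>\<^sub>a \<eta> c' a)"
    using tensor_Comp[OF Ic Ic n Hg] Comp_Id[OF Ic]
      Comp_assoc[OF tensor_hom[OF Ic n] tensor_hom[OF Ic Hg] eps_hom[OF O(1,4)]] by simp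
  also have "\<dots> = \<epsilon> c' (c' \<otimes> a) \<cdot> ((g \<otimes>\<^sub>a Id C ?x) \<cdot> (Id C c \<otimes>\<^sub>a \<eta> c' a))"
    using counit_H[OF g Id_hom[OF O(4)]] Id_Comp[OF Comp_hom[OF gx e]]
      Comp_assoc[OF tensor_hom[OF Ic n] gx e] by simp
  also have "\<dots> = (\<epsilon> c' (c' \<otimes> a) \<cdot> (Id C c' \<otimes>\<^sub>a \<eta> c' a)) \<cdot> (g \<otimes>\<^sub>a Id C a)"
    using tensor_slide[OF g n] Comp_assoc[OF ga tensor_hom[OF Id_hom[OF O(2)] n] e] by simp
  also have "\<dots> = g \<otimes>\<^sub>a Id C a"
    using triangles(1)[OF adj[OF O(2)] a] Id_Comp[OF ga] by simp
  also have "\<dots> = \<epsilon> c (c' \<otimes> a) \<cdot> (Id C c \<otimes>\<^sub>a (amap H (Id C c, g \<otimes>\<^sub>a Id C a) \<cdot> \<eta> c a))"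
    unfolding t using counit_transpose[OF adj[OF O(1)] a ga'] by simp
  finally show ?thesis
    unfolding t by (rule eps_cancel[OF O(1,4) Comp_hom[OF n Hg] transpose_hom[OF adj[OF O(1)] a ga']])
qed

lemma hom_of_closed_data: "hom_of_closed C S \<in> internal_hom_data C"
proof -
  define ev where "ev = (\<lambda>(c, a) \<in> Ob C \<times> Ob C. \<epsilon> c a)"
  define coev where "coev = (\<lambda>(c, a) \<in> Ob C \<times> Ob C. \<eta> c a)"
  have eq: "hom_of_closed C S = (H, ev, coev)"
    by (simp add: hom_of_closed_def Let_def ev_def coev_def)
  have s: "ev (c, a) = \<epsilon> c a" "coev (c, a) = \<eta> c a" if "c \<in> Ob C" "a \<in> Ob C" for c a
    using that by (auto simp: ev_def coev_def)
  have ext: "ev \<in> extensional (Ob C \<times> Ob C)" "coev \<in> extensional (Ob C \<times> Ob C)"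
    by (auto simp: ev_def coev_def)
  have "H \<in> functors (prod_cat (op_cat C) C) C"
    using H_functor by (auto simp: functors_def) (auto simp: hom_of_closed_def)
  moreover have "is_extranat C terminal_cat C C (tensor C \<circ>\<^sub>f (id_fctr \<times>\<^sub>f H)) fst_fctr
      (\<lambda>c a _. ev (c, a))"
  proof (unfold is_extranat_ev_iff, intro conjI ballI)
    fix c c' f a assume *: "c \<in> Ob C" "c' \<in> Ob C" "f \<in> hom C c c'" "a \<in> Ob C"
    show "ev (c', a) \<cdot> (f \<otimes>\<^sub>a Id C (omap H (c', a))) = ev (c, a) \<cdot> (Id C c \<otimes>\<^sub>a amap H (f, Id C a))"
      using * counit_H[OF *(3) Id_hom[OF *(4)]]
        Id_Comp[OF Comp_hom[OF tensor_hom[OF *(3) Id_hom[OF R_Ob[OF *(2,4)]]] eps_hom[OF *(2,4)]]]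
      by (simp add: s H_omap)
  next
    fix c a a' h assume *: "c \<in> Ob C" "a \<in> Ob C" "a' \<in> Ob C" "h \<in> hom C a a'"
    show "ev (c, a') \<cdot> (Id C c \<otimes>\<^sub>a amap H (Id C c, h)) = h \<cdot> ev (c, a)"
      using * counit_natural[OF adj[OF *(1)] *(4)] by (simp add: s H_Id_left[OF *(1,4)])
  qed (simp add: s H_omap eps_hom)
  moreover have "is_extranat C C terminal_cat C (snd_fctr \<circ>\<^sub>f snd_fctr)
      (H \<circ>\<^sub>f (id_fctr \<times>\<^sub>f tensor C) \<circ>\<^sub>f rotate_fctr) (\<lambda>_ a c. coev (c, a))"
  proof (unfold is_extranat_coev_iff, intro conjI ballI)
    fix a a' h c assume *: "a \<in> Ob C" "a' \<in> Ob C" "h \<in> hom C a a'" "c \<in> Ob C"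
    show "coev (c, a') \<cdot> h = amap H (Id C c, Id C c \<otimes>\<^sub>a h) \<cdot> coev (c, a)"
      using * unit_natural[OF adj[OF *(4)] *(3)]
      by (simp add: s H_Id_left[OF *(4) tensor_hom[OF Id_hom[OF *(4)] *(3)]])
  qed (simp_all add: s H_omap eta_hom tensor_Ob unit_extranatural)
  moreover have "amap H (Id C c, ev (c, a)) \<cdot> coev (c, omap H (c, a)) = Id C (omap H (c, a))"
    if "c \<in> Ob C" "a \<in> Ob C" for c a
    using that triangles(2)[OF adj] by (simp add: s H_omap R_Ob H_Id_left[OF _ eps_hom])
  moreover have "ev (c, c \<otimes> a) \<cdot> (Id C c \<otimes>\<^sub>a coev (c, a)) = Id C (c \<otimes> a)"
    if "c \<in> Ob C" "a \<in> Ob C" for c a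
    using that triangles(1)[OF adj[OF that(1)] that(2)] by (simp add: s tensor_Ob)
  ultimately have "(H, ev, coev) \<in> internal_hom_data C"
    using ext by (simp add: internal_hom_data_def)
  then show ?thesis by (subst eq)
qed

text \<open>The functors \<open>H(c, -)\<close> are the given \<open>R\<^sub>c\<close> by \<open>H_Id_left\<close>, and counits and units are copied.\<close>
lemma closed_of_hom_of_closed: "closed_of_hom C (hom_of_closed C S) = S"
proof (rule extensionalityI)
  show "closed_of_hom C (hom_of_closed C S) \<in> extensional (Ob C)"
    by (auto simp: closed_of_hom_def split: prod.split)
  show "S \<in> extensional (Ob C)"
    using S by (auto simp: left_closed_structures_def PiE_def)
  fix c assume c: "c \<in> Ob C"
  have R: "omap (R c) \<in> extensional (Ob C)" "amap (R c) \<in> extensional (Arr C)"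
    using R_functors[OF c] by (auto simp: functors_def)
  have "(\<lambda>a \<in> Ob C. omap H (c, a)) = omap (R c)"
    by (rule extensionalityI[OF _ R(1)]) (auto simp: H_omap c)
  moreover have "(\<lambda>h \<in> Arr C. amap H (Id C c, h)) = amap (R c)"
    by (rule extensionalityI[OF _ R(2)]) (auto simp: H_Id_left[OF c Arr_hom])
  moreover have "(\<lambda>a \<in> Ob C. fst (snd (hom_of_closed C S)) (c, a)) = \<epsilon> c"
    by (rule extensionalityI[OF _ counit_extensional[OF c]]) (auto simp: c hom_of_closed_def)
  moreover have "(\<lambda>a \<in> Ob C. snd (snd (hom_of_closed C S)) (c, a)) = \<eta> c"
    by (rule extensionalityI[OF _ unit_extensional[OF c]]) (auto simp: c hom_of_closed_def)
  ultimately show "closed_of_hom C (hom_of_closed C S) c = S c"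
    using c by (simp add: closed_of_hom_def case_prod_beta prod_eq_iff)
qed

end

theorem theorem3p6:
  fixes C :: "('o, 'm, 'x) moncat_scheme"
  assumes "monoidal_category C"
  shows "bij_betw (closed_of_hom C) (internal_hom_data C) (left_closed_structures C)"
proof (rule bij_betw_byWitness[where f' = "hom_of_closed C"])
  have L: "left_closed_category C S" if "S \<in> left_closed_structures C" for S
    using assms that by (simp add: left_closed_category_def left_closed_category_axioms_def)
  show "\<forall>d \<in> internal_hom_data C. hom_of_closed C (closed_of_hom C d) = d"
    using hom_of_closed_of_hom[OF assms] by blast
  show "\<forall>S \<in> left_closed_structures C. closed_of_hom C (hom_of_closed C S) = S"
    using left_closed_category.closed_of_hom_of_closed[OF L] by blast
  show "closed_of_hom C ` internal_hom_data C \<subseteq> left_closed_structures C"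
    using closed_of_hom_left_closed[OF assms] by blast
  show "hom_of_closed C ` left_closed_structures C \<subseteq> internal_hom_data C"
    using left_closed_category.hom_of_closed_data[OF L] by blast
qed

end
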